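(* Let $\Gamma$ be a cancelation monoid with neutral element $e$, let $A=\bigoplus_{\gamma\in\Gamma}A_\gamma$ be a $\Gamma$-graded local ring, and let $M$ be a finitely generated $\Gamma$-graded $A$-module. (i) Any two minimal homogeneous generating sets of $M$ have the same number of generators. (ii) If $\Gamma$ is a totally ordered monoid with total ordering $\prec$ such that the neutral element $e$ is the smallest element of $\Gamma$, then any two minimal homogeneous generating sets of $M$ contain the same number of homogeneous elements of degree $\gamma$, for every $\gamma\in\Gamma$.
   Context: Rings are associative with identity $1$, not necessarily commutative; modules are unitary left modules. A cancelation monoid is a (not necessarily commutative) monoid satisfying the left and right cancelation laws. A $\Gamma$-graded ring is a ring $A=\bigoplus_{\gamma\in\Gamma}A_\gamma$ (additive subgroups) with $A_{\gamma_1}A_{\gamma_2}\subseteq A_{\gamma_1\gamma_2}$; a $\Gamma$-graded $A$-module is a module $M=\bigoplus_{\gamma\in\Gamma}M_\gamma$ (additive subgroups) with $A_{\gamma_1}M_{\gamma_2}\subseteq M_{\gamma_1\gamma_2}$. A homogeneous element of degree $\gamma$ of $M$ is a nonzero element of $M_\gamma$. A $\Gamma$-graded local ring is a $\Gamma$-graded ring $A$ whose degree-$e$ part $A_e$ is a local ring (it has a unique maximal left ideal, which is also its unique maximal right and two-sided ideal). A minimal homogeneous generating set of $M$ is a generating set consisting of homogeneous elements such that no proper subset generates $M$. A totally ordered monoid is a monoid with a total ordering $\prec$ such that $\gamma_1\prec\gamma_2$ implies $\gamma_1\gamma\prec\gamma_2\gamma$ and $\gamma\gamma_1\prec\gamma\gamma_2$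 for all $\gamma$. *)

theory Defs
  imports "HOL-Algebra.Algebra" "HOL-Library.Equipollence"
begin

text \<open>
  HOL-Algebra's module locale is restricted to commutative rings. The locale below has the
  same axioms over an arbitrary ring; the library notion of submodule (a subgroup of the additive
  group closed under scalars) makes no commutativity assumption and is reused.
\<close>

locale left_module = R?: ring R + M?: abelian_group M
  for R :: "('a, 'c) ring_scheme" (structure) and M :: "('a, 'b, 'd) module_scheme" (structure) +
  assumes smult_closed:
      "\<lbrakk>a \<in> carrier R; x \<in> carrier M\<rbrakk> \<Longrightarrow> a \<odot>\<^bsub>M\<^esub> x \<in> carrier M"
    and smult_l_distr:
      "\<lbrakk>a \<in> carrier R; b \<in> carrier R; x \<in> carrier M\<rbrakk> \<Longrightarrow>
        (a \<oplus>\<^bsub>R\<^esub> b) \<odot>\<^bsub>M\<^esub> x = a \<odot>\<^bsub>M\<^esub> x \<oplus>\<^bsub>M\<^esub> b \<odot>\<^bsub>M\<^esub> x"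
    and smult_r_distr:
      "\<lbrakk>a \<in> carrier R; x \<in> carrier M; y \<in> carrier M\<rbrakk> \<Longrightarrow>
        a \<odot>\<^bsub>M\<^esub> (x \<oplus>\<^bsub>M\<^esub> y) = a \<odot>\<^bsub>M\<^esub> x \<oplus>\<^bsub>M\<^esub> a \<odot>\<^bsub>M\<^esub> y"
    and smult_assoc1:
      "\<lbrakk>a \<in> carrier R; b \<in> carrier R; x \<in> carrier M\<rbrakk> \<Longrightarrow>
        (a \<otimes>\<^bsub>R\<^esub> b) \<odot>\<^bsub>M\<^esub> x = a \<odot>\<^bsub>M\<^esub> (b \<odot>\<^bsub>M\<^esub> x)"
    and smult_one:
      "x \<in> carrier M \<Longrightarrow> \<one>\<^bsub>R\<^esub> \<odot>\<^bsub>M\<^esub> x = x"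

definition generates ::
    "('a, 'c) ring_scheme \<Rightarrow> ('a, 'b, 'd) module_scheme \<Rightarrow> 'b set \<Rightarrow> bool" where
  "generates R M S \<longleftrightarrow>
     S \<subseteq> carrier M \<and> (\<lambda>N. submodule N R M) hull S = carrier M"

definition finitely_generated ::
    "('a, 'c) ring_scheme \<Rightarrow> ('a, 'b, 'd) module_scheme \<Rightarrow> bool" where
  "finitely_generated R M \<longleftrightarrow> (\<exists>S. finite S \<and> generates R M S)"

locale left_ideal = additive_subgroup I R + ring R
  for I and R (structure) +
  assumes I_l_closed: "\<lbrakk>a \<in> I; x \<in> carrier R\<rbrakk> \<Longrightarrow> x \<otimes> a \<in> I"

locale maximal_left_ideal = left_ideal +
  assumes I_notcarr: "carrier R \<noteq> I"
    and I_maximal: "\<lbrakk>left_ideal J R; I \<subseteq> J; J \<subseteq> carrier R\<rbrakk> \<Longrightarrow> J = I \<or> J = carrier R"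

text \<open>
  In a ring with exactly one maximal left ideal, that ideal is automatically two-sided and also the
  unique maximal right ideal. The zero ring is excluded, since it has no maximal left ideal.
\<close>

locale local_ring = ring +
  assumes unique_maximal_left_ideal: "\<exists>!I. maximal_left_ideal I R"

text \<open>
  The extensional function \<open>c\<close> is the family of components of \<open>x\<close>; only the additive structure
  of \<open>M\<close> matters.
\<close>

definition internal_direct_sum :: "('b, 'c) ring_scheme \<Rightarrow> 'i set \<Rightarrow> ('i \<Rightarrow> 'b set) \<Rightarrow> bool" where
  "internal_direct_sum M I F \<longleftrightarrow>
     (\<forall>i\<in>I. additive_subgroup (F i) M) \<and>
     (\<forall>x\<in>carrier M. \<exists>!c. c \<in> (\<Pi>\<^sub>E i\<in>I. F i) \<and>
        finite {i \<in> I. c i \<noteq> \<zero>\<^bsub>M\<^esub>} \<and>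
        x = (\<Oplus>\<^bsub>M\<^esub>i\<in>{i \<in> I. c i \<noteq> \<zero>\<^bsub>M\<^esub>}. c i))"

locale graded_ring = \<Gamma>?: monoid \<Gamma> + A?: ring A
  for \<Gamma> :: "('g, 'h) monoid_scheme" (structure)
    and A :: "('a, 'c) ring_scheme" (structure)
    and \<A> :: "'g \<Rightarrow> 'a set" +
  assumes ring_direct_sum: "internal_direct_sum A (carrier \<Gamma>) \<A>"
    and mult_degree:
      "\<lbrakk>\<gamma> \<in> carrier \<Gamma>; \<delta> \<in> carrier \<Gamma>; a \<in> \<A> \<gamma>; b \<in> \<A> \<delta>\<rbrakk> \<Longrightarrow>
        a \<otimes>\<^bsub>A\<^esub> b \<in> \<A> (\<gamma> \<otimes>\<^bsub>\<Gamma>\<^esub> \<delta>)"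

locale graded_local_ring = graded_ring +
  assumes local_ring_degree_one: "local_ring (A\<lparr>carrier := \<A> \<one>\<^bsub>\<Gamma>\<^esub>\<rparr>)"

locale graded_module = graded_ring \<Gamma> A \<A> + left_module A M
  for \<Gamma> :: "('g, 'h) monoid_scheme" (structure)
    and A :: "('a, 'c) ring_scheme" (structure)
    and \<A> :: "'g \<Rightarrow> 'a set"
    and M :: "('a, 'b, 'd) module_scheme" (structure)
    and \<M> :: "'g \<Rightarrow> 'b set" +
  assumes module_direct_sum: "internal_direct_sum M (carrier \<Gamma>) \<M>"
    and smult_degree:
      "\<lbrakk>\<gamma> \<in> carrier \<Gamma>; \<delta> \<in> carrier \<Gamma>; a \<in> \<A> \<gamma>; x \<in> \<M> \<delta>\<rbrakk> \<Longrightarrow>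
        a \<odot>\<^bsub>M\<^esub> x \<in> \<M> (\<gamma> \<otimes>\<^bsub>\<Gamma>\<^esub> \<delta>)"

definition homogeneous_of_degree ::
    "('b, 'c) ring_scheme \<Rightarrow> ('g \<Rightarrow> 'b set) \<Rightarrow> 'g \<Rightarrow> 'b \<Rightarrow> bool" where
  "homogeneous_of_degree M \<M> \<gamma> x \<longleftrightarrow> x \<in> \<M> \<gamma> \<and> x \<noteq> \<zero>\<^bsub>M\<^esub>"

definition minimal_homogeneous_generating_set ::
    "('g, 'h) monoid_scheme \<Rightarrow> ('a, 'c) ring_scheme \<Rightarrow>
     ('a, 'b, 'd) module_scheme \<Rightarrow> ('g \<Rightarrow> 'b set) \<Rightarrow> 'b set \<Rightarrow> bool" where
  "minimal_homogeneous_generating_set \<Gamma> A M \<M> S \<longleftrightarrow>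
     (\<forall>x\<in>S. \<exists>\<gamma>\<in>carrier \<Gamma>. homogeneous_of_degree M \<M> \<gamma> x) \<and>
     generates A M S \<and> (\<forall>T. T \<subset> S \<longrightarrow> \<not> generates A M T)"

text \<open>The relation \<open>r\<close> is the strict order: \<open>(\<gamma>, \<delta>) \<in> r\<close> reads \<open>\<gamma> \<prec> \<delta>\<close>.\<close>

locale totally_ordered_monoid = monoid G for G (structure) and r +
  assumes strict_linear_order: "strict_linear_order_on (carrier G) r"
    and mult_right_mono:
      "\<lbrakk>x \<in> carrier G; y \<in> carrier G; z \<in> carrier G; (x, y) \<in> r\<rbrakk> \<Longrightarrow> (x \<otimes> z, y \<otimes> z) \<in> r"
    and mult_left_mono:
      "\<lbrakk>x \<in> carrier G; y \<in> carrier G; z \<in> carrier G; (x, y) \<in> r\<rbrakk> \<Longrightarrow> (z \<otimes> x, z \<otimes> y) \<in> r"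

end

theory Submission
  imports Defs
begin

text \<open>
  The idea is a Steinitz exchange. Let \<open>S\<close> be a minimal and \<open>T\<close> a finite homogeneous generating set,
  \<open>s \<in> S - T\<close>, and \<open>N\<close> the submodule generated by \<open>S - {s}\<close>, so that \<open>s \<notin> N\<close>. Write
  \<open>s = \<Sum> a\<^sub>t t\<close> and \<open>t = b\<^sub>t s + n\<^sub>t\<close> with \<open>t \<in> T\<close>, \<open>n\<^sub>t \<in> N\<close> and homogeneous coefficients; by
  cancelation every nonzero \<open>a\<^sub>t b\<^sub>t\<close> has degree \<open>e\<close>. If all of them were in the maximal ideal \<open>J\<close> of
  \<open>A\<^sub>e\<close>, then \<open>(1 - j) s \<in> N\<close> for some \<open>j \<in> J\<close>, hence \<open>s \<in> N\<close>. So some \<open>a\<^sub>t b\<^sub>t\<close> is a unit, and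
  then \<open>a\<^sub>t\<close> is left invertible, which allows \<open>s\<close> to replace \<open>t\<close> in \<open>T\<close>. The degrees of \<open>s\<close> and \<open>t\<close>
  differ by an invertible factor, which is \<open>e\<close> when \<open>e\<close> is the smallest element.
\<close>

subsection \<open>Left ideals and local rings\<close>

lemma additive_subgroupI':
  assumes "abelian_group M" "H \<subseteq> carrier M" "\<zero>\<^bsub>M\<^esub> \<in> H"
    and "\<And>x y. \<lbrakk>x \<in> H; y \<in> H\<rbrakk> \<Longrightarrow> x \<oplus>\<^bsub>M\<^esub> y \<in> H"
    and "\<And>x. x \<in> H \<Longrightarrow> \<ominus>\<^bsub>M\<^esub> x \<in> H"
  shows "additive_subgroup H M"
  using assms
  by (intro additive_subgroup.intro subgroup.intro) (auto simp: a_inv_def)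

text \<open>Negatives come for free: \<open>\<ominus> x\<close> is \<open>x\<close> multiplied on
  the left by \<open>\<ominus> \<one>\<close>.\<close>

lemma (in ring) left_idealI:
  assumes "I \<subseteq> carrier R" "\<zero> \<in> I"
    and add: "\<And>x y. \<lbrakk>x \<in> I; y \<in> I\<rbrakk> \<Longrightarrow> x \<oplus> y \<in> I"
    and mult: "\<And>a x. \<lbrakk>a \<in> carrier R; x \<in> I\<rbrakk> \<Longrightarrow> a \<otimes> x \<in> I"
  shows "left_ideal I R"
proof -
  have "\<ominus> x \<in> I" if "x \<in> I" for x
  proof -
    have "\<ominus> x = (\<ominus> \<one>) \<otimes> x"
      using that assms(1) by (simp add: l_minus subset_iff)
    then show ?thesis
      using mult that by simp
  qed
  then show ?thesis
    using assms
    by (intro left_ideal.intro additive_subgroupI' left_ideal_axioms.intro ring_axioms is_abelian_group) auto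
qed

text \<open>Zorn's lemma on the left ideals that contain \<open>I\<close> and avoid
  \<open>\<one>\<close>; avoiding \<open>\<one>\<close> amounts to being proper and survives unions
  of chains.\<close>

lemma (in ring) exists_maximal_left_ideal:
  assumes I: "left_ideal I R" "\<one> \<notin> I"
  shows "\<exists>K. maximal_left_ideal K R \<and> I \<subseteq> K"
proof -
  define P where "P = {K. left_ideal K R \<and> I \<subseteq> K \<and> \<one> \<notin> K}"
  have "\<Union>C \<in> P" if C: "C \<noteq> {}" "subset.chain P C" for C
  proof -
    have CP: "left_ideal K R" "I \<subseteq> K" "\<one> \<notin> K" if "K \<in> C" for K
      using C(2) that by (auto simp: P_def subset.chain_def)
    have sub: "K \<subseteq> carrier R" "\<zero> \<in> K"
      and add: "\<And>x y. x \<in> K \<Longrightarrow> y \<in> K \<Longrightarrow> x \<oplus> y \<in> K" if "K \<in> C" for K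
      using CP(1)[OF that]
      by (auto simp: left_ideal_def additive_subgroup.a_subset additive_subgroup.zero_closed
          additive_subgroup.a_closed dest: additive_subgroup.a_subset)
    have "left_ideal (\<Union>C) R"
    proof (rule left_idealI)
      show "\<Union>C \<subseteq> carrier R" using sub by blast
      show "\<zero> \<in> \<Union>C" using sub C(1) by blast
    next
      fix x y assume "x \<in> \<Union>C" "y \<in> \<Union>C"
      then obtain K L where "K \<in> C" "x \<in> K" "L \<in> C" "y \<in> L"
        by blast
      \<comment> \<open>Comparability in the chain puts both summands into one member.\<close>
      moreover from this have "K \<subseteq> L \<or> L \<subseteq> K"
        using C(2) unfolding subset_chain_def by blast
      ultimately obtain K where "K \<in> C" "x \<in> K" "y \<in> K"
        by blast
      then show "x \<oplus> y \<in> \<Union>C" using add by blast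
    next
      fix a x assume a: "a \<in> carrier R" and "x \<in> \<Union>C"
      then obtain K where K: "K \<in> C" "x \<in> K"
        by blast
      then have "a \<otimes> x \<in> K"
        using left_ideal.I_l_closed[OF CP(1)] a by simp
      then show "a \<otimes> x \<in> \<Union>C"
        using K by blast
    qed
    moreover have "I \<subseteq> \<Union>C"
      using CP(2) C(1) by blast
    ultimately show ?thesis
      using CP(3) by (auto simp: P_def)
  qed
  moreover have "P \<noteq> {}"
    using I by (auto simp: P_def)
  ultimately obtain K where K: "K \<in> P" and max: "\<And>L. \<lbrakk>L \<in> P; K \<subseteq> L\<rbrakk> \<Longrightarrow> L = K"
    using subset_Zorn_nonempty[of P] by blast
  have "maximal_left_ideal K R"
  proof (rule maximal_left_ideal.intro)
    show "left_ideal K R" using K by (simp add: P_def)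
    show "maximal_left_ideal_axioms K R"
    proof
      show "carrier R \<noteq> K" using K by (auto simp: P_def)
    next
      fix J assume J: "left_ideal J R" "K \<subseteq> J" "J \<subseteq> carrier R"
      show "J = K \<or> J = carrier R"
      \<comment> \<open>A left ideal containing \<open>\<one>\<close> is the whole ring; any other
        \<open>J\<close> above \<open>K\<close> lies in \<open>P\<close>, where \<open>K\<close> is
        maximal.\<close>
      proof (cases "\<one> \<in> J")
        case True
        have "a \<in> J" if "a \<in> carrier R" for a
          using left_ideal.I_l_closed[OF J(1) True that] that by simp
        then show ?thesis using J by auto
      next
        case False
        then show ?thesis using max[of J] J K by (auto simp: P_def)
      qed
    qed
  qed
  then show ?thesis
    using K by (auto simp: P_def)
qed

text \<open>\<open>J\<close> is the unique maximal left ideal. If \<open>x\<close> has no left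
  inverse, the principal left ideal of \<open>x\<close> is proper, so it lies in some maximal left
  ideal, which can only be \<open>J\<close>.\<close>

lemma (in local_ring) exists_left_ideal_of_noninvertibles:
  obtains J where "left_ideal J R" "\<one> \<notin> J"
    "\<And>x. \<lbrakk>x \<in> carrier R; x \<notin> J\<rbrakk> \<Longrightarrow> \<exists>y\<in>carrier R. y \<otimes> x = \<one>"
proof -
  obtain J where J: "maximal_left_ideal J R" and uniq: "\<And>K. maximal_left_ideal K R \<Longrightarrow> K = J"
    using unique_maximal_left_ideal by blast
  interpret maximal_left_ideal J R by (rule J)
  show thesis
  proof (rule that)
    show "left_ideal J R" ..
    show "\<one> \<notin> J"
      using I_l_closed[of \<one>] I_notcarr a_subset by force
    fix x assume x: "x \<in> carrier R" "x \<notin> J"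
    define I where "I = (\<lambda>y. y \<otimes> x) ` carrier R"
    have "left_ideal I R"
    proof (rule left_idealI)
      show "\<zero> \<in> I"
        unfolding I_def using x by (intro image_eqI[of _ _ \<zero>]) auto
    qed (use x in \<open>auto simp: I_def l_distr[symmetric] m_assoc[symmetric]\<close>)
    moreover have "x \<in> I"
      unfolding I_def using x by (intro image_eqI[of _ _ \<one>]) auto
    ultimately have "\<one> \<in> I"
      using exists_maximal_left_ideal[of I] uniq x(2) by blast
    then show "\<exists>y\<in>carrier R. y \<otimes> x = \<one>"
      by (auto simp: I_def)
  qed
qed

subsection \<open>Homogeneous components\<close>

text \<open>Only the additive group enters, so the locale can be instantiated both with the graded
  ring and with the graded module.\<close>

locale direct_sum_decomposition = abelian_group M for M (structure) and I F +
  assumes direct_sum: "internal_direct_sum M I F"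
begin

definition components :: "'a \<Rightarrow> 'c \<Rightarrow> 'a" where
  "components x = (THE c. c \<in> (\<Pi>\<^sub>E i\<in>I. F i) \<and> finite {i \<in> I. c i \<noteq> \<zero>} \<and>
     x = (\<Oplus>i\<in>{i \<in> I. c i \<noteq> \<zero>}. c i))"

lemma summand_subgroup: "i \<in> I \<Longrightarrow> additive_subgroup (F i) M"
  using direct_sum by (auto simp: internal_direct_sum_def)

lemma summand_closed: "i \<in> I \<Longrightarrow> x \<in> F i \<Longrightarrow> x \<in> carrier M"
  using additive_subgroup.a_subset[OF summand_subgroup] by blast

lemma zero_in_summand: "i \<in> I \<Longrightarrow> \<zero> \<in> F i"
  using additive_subgroup.zero_closed[OF summand_subgroup] .

lemma add_in_summand: "\<lbrakk>i \<in> I; x \<in> F i; y \<in> F i\<rbrakk> \<Longrightarrow> x \<oplus> y \<in> F i"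
  using additive_subgroup.a_closed[OF summand_subgroup] .

lemma components:
  assumes "x \<in> carrier M"
  shows "components x \<in> (\<Pi>\<^sub>E i\<in>I. F i)" "finite {i \<in> I. components x i \<noteq> \<zero>}"
    "x = (\<Oplus>i\<in>{i \<in> I. components x i \<noteq> \<zero>}. components x i)"
proof -
  have "\<exists>!c. c \<in> (\<Pi>\<^sub>E i\<in>I. F i) \<and> finite {i \<in> I. c i \<noteq> \<zero>} \<and> x = (\<Oplus>i\<in>{i \<in> I. c i \<noteq> \<zero>}. c i)"
    using direct_sum assms unfolding internal_direct_sum_def by blast
  from theI'[OF this] show "components x \<in> (\<Pi>\<^sub>E i\<in>I. F i)" "finite {i \<in> I. components x i \<noteq> \<zero>}"
    "x = (\<Oplus>i\<in>{i \<in> I. components x i \<noteq> \<zero>}. components x i)"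
    unfolding components_def by blast+
qed

text \<open>The index set \<open>J\<close> may exceed the support of \<open>c\<close>. This freedom
  matters for sums, where components can cancel.\<close>

lemma components_eqI:
  assumes "c \<in> (\<Pi>\<^sub>E i\<in>I. F i)" "finite J" "J \<subseteq> I" "\<And>i. i \<in> I - J \<Longrightarrow> c i = \<zero>"
    and x: "x = (\<Oplus>i\<in>J. c i)"
  shows "components x = c"
proof -
  have c: "c \<in> J \<rightarrow> carrier M"
    using assms(1,3) summand_closed by (fastforce simp: PiE_def Pi_def)
  then have xM: "x \<in> carrier M"
    using x by simp
  have sub: "{i \<in> I. c i \<noteq> \<zero>} \<subseteq> J"
    using assms(4) by blast
  have "(\<Oplus>i\<in>J. c i) = (\<Oplus>i\<in>{i \<in> I. c i \<noteq> \<zero>}. c i)"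
    by (rule add.finprod_mono_neutral_cong_right) (use assms c sub in auto)
  moreover have "finite {i \<in> I. c i \<noteq> \<zero>}"
    using sub assms(2) finite_subset by blast
  moreover have "\<exists>!c. c \<in> (\<Pi>\<^sub>E i\<in>I. F i) \<and> finite {i \<in> I. c i \<noteq> \<zero>} \<and> x = (\<Oplus>i\<in>{i \<in> I. c i \<noteq> \<zero>}. c i)"
    using direct_sum xM unfolding internal_direct_sum_def by blast
  ultimately show ?thesis
    unfolding components_def using assms(1) x by (intro the1_equality) auto
qed

lemma component_in_summand: "\<lbrakk>i \<in> I; x \<in> carrier M\<rbrakk> \<Longrightarrow> components x i \<in> F i"
  using components(1) by blast

lemma component_closed: "\<lbrakk>i \<in> I; x \<in> carrier M\<rbrakk> \<Longrightarrow> components x i \<in> carrier M"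
  using component_in_summand summand_closed by blast

lemma component_add:
  assumes x: "x \<in> carrier M" and y: "y \<in> carrier M" and i: "i \<in> I"
  shows "components (x \<oplus> y) i = components x i \<oplus> components y i"
proof -
  define J where "J = {i \<in> I. components x i \<noteq> \<zero>} \<union> {i \<in> I. components y i \<noteq> \<zero>}"
  define c where "c = (\<lambda>i\<in>I. components x i \<oplus> components y i)"
  have fin: "finite J"
    using x y components by (simp add: J_def)
  have J: "J \<subseteq> I"
    by (auto simp: J_def)
  have cl: "components z \<in> J \<rightarrow> carrier M" if "z \<in> carrier M" for z
    using that J component_closed by blast
  \<comment> \<open>Padding with zeros writes \<open>x\<close> and \<open>y\<close> over the common
    index set \<open>J\<close>, so that they can be added termwise.\<close>
  have *: "z = (\<Oplus>i\<in>J. components z i)" if "z \<in> {x, y}" for z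
  proof -
    have "(\<Oplus>i\<in>J. components z i) = (\<Oplus>i\<in>{i \<in> I. components z i \<noteq> \<zero>}. components z i)"
      by (rule add.finprod_mono_neutral_cong_right)
        (use that fin J x y cl in \<open>auto simp: J_def\<close>)
    then show ?thesis
      using that x y components(3) by force
  qed
  have "components (x \<oplus> y) = c"
  proof (rule components_eqI[OF _ fin J])
    show "c \<in> (\<Pi>\<^sub>E i\<in>I. F i)"
      using x y add_in_summand component_in_summand by (auto simp: c_def)
    show "c i = \<zero>" if "i \<in> I - J" for i
      using that by (auto simp: c_def J_def)
    have "(\<Oplus>i\<in>J. c i) = (\<Oplus>i\<in>J. components x i \<oplus> components y i)"
      using J x y component_closed by (intro add.finprod_cong') (auto simp: c_def)
    also have "\<dots> = x \<oplus> y"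
      using * cl x y by (subst add.finprod_multf) auto
    finally show "x \<oplus> y = (\<Oplus>i\<in>J. c i)" ..
  qed
  then show ?thesis
    using i by (simp add: c_def)
qed

lemma component_of_summand:
  assumes "i \<in> I" "j \<in> I" "x \<in> F i"
  shows "components x j = (if j = i then x else \<zero>)"
proof -
  have "components x = (\<lambda>j\<in>I. if j = i then x else \<zero>)"
    by (rule components_eqI[where J = "{i}"])
      (use assms zero_in_summand summand_closed in auto)
  then show ?thesis
    using assms(2) by simp
qed

lemma component_zero: "i \<in> I \<Longrightarrow> components \<zero> i = \<zero>"
  using component_of_summand[of i i] zero_in_summand by simp

text \<open>The base case concerns only the components of the given \<open>x\<close>, so whatever is
  known about these particular components is available there.\<close>

lemma direct_sum_induct [consumes 1, case_names zero summand add]: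
  assumes "x \<in> carrier M" "P \<zero>"
    and summand: "\<And>i. i \<in> I \<Longrightarrow> P (components x i)"
    and add: "\<And>x y. \<lbrakk>x \<in> carrier M; y \<in> carrier M; P x; P y\<rbrakk> \<Longrightarrow> P (x \<oplus> y)"
  shows "P x"
proof -
  have "P (\<Oplus>i\<in>J. components x i)" if "finite J" "J \<subseteq> I" for J
    using that
  proof induction
    case (insert j J)
    then have "components x \<in> J \<rightarrow> carrier M" "components x j \<in> carrier M"
      using assms(1) component_closed by auto
    moreover have "P (components x j)"
      using insert summand by blast
    ultimately show ?case
      using insert add by simp
  qed (simp add: assms(2))
  from this[OF components(2)[OF assms(1)]] show ?thesis
    using components(3)[OF assms(1)] by auto
qed

end

subsection \<open>Generated submodules\<close>

context left_module
begin

text \<open>For \<open>S\<close> outside the carrier no submodule contains \<open>S\<close> and the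
  hull is the universal set; hence the assumptions \<open>S \<subseteq> carrier M\<close>
  below.\<close>

abbreviation span :: "'b set \<Rightarrow> 'b set" where
  "span S \<equiv> (\<lambda>N. submodule N R M) hull S"

lemma smult_l_null: "x \<in> carrier M \<Longrightarrow> \<zero>\<^bsub>R\<^esub> \<odot>\<^bsub>M\<^esub> x = \<zero>\<^bsub>M\<^esub>"
  using smult_l_distr[of "\<zero>\<^bsub>R\<^esub>" "\<zero>\<^bsub>R\<^esub>" x] smult_closed[of "\<zero>\<^bsub>R\<^esub>" x]
  by (simp add: M.add.l_cancel_one)

lemma smult_r_null: "a \<in> carrier R \<Longrightarrow> a \<odot>\<^bsub>M\<^esub> \<zero>\<^bsub>M\<^esub> = \<zero>\<^bsub>M\<^esub>"
  using smult_r_distr[of a "\<zero>\<^bsub>M\<^esub>" "\<zero>\<^bsub>M\<^esub>"] smult_closed[of a "\<zero>\<^bsub>M\<^esub>"]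
  by (simp add: M.add.l_cancel_one)

text \<open>This turns closure under scalars into closure under negation.\<close>

lemma smult_minus_one: "x \<in> carrier M \<Longrightarrow> (\<ominus>\<^bsub>R\<^esub> \<one>\<^bsub>R\<^esub>) \<odot>\<^bsub>M\<^esub> x = \<ominus>\<^bsub>M\<^esub> x"
  using smult_l_distr[of "\<ominus>\<^bsub>R\<^esub> \<one>\<^bsub>R\<^esub>" "\<one>\<^bsub>R\<^esub>" x] smult_closed[of "\<ominus>\<^bsub>R\<^esub> \<one>\<^bsub>R\<^esub>" x]
  by (simp add: smult_one smult_l_null R.l_neg M.minus_equality)

lemma submoduleI:
  assumes "N \<subseteq> carrier M" "\<zero>\<^bsub>M\<^esub> \<in> N"
    and "\<And>x y. \<lbrakk>x \<in> N; y \<in> N\<rbrakk> \<Longrightarrow> x \<oplus>\<^bsub>M\<^esub> y \<in> N"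
    and smult: "\<And>a x. \<lbrakk>a \<in> carrier R; x \<in> N\<rbrakk> \<Longrightarrow> a \<odot>\<^bsub>M\<^esub> x \<in> N"
  shows "submodule N R M"
proof -
  have "\<ominus>\<^bsub>M\<^esub> x \<in> N" if "x \<in> N" for x
    using smult[of "\<ominus>\<^bsub>R\<^esub> \<one>\<^bsub>R\<^esub>" x] that assms(1) by (simp add: smult_minus_one subset_iff)
  then show ?thesis
    using assms additive_subgroupI'[OF M.abelian_group_axioms, of N]
    by (auto simp: submodule_def additive_subgroup_def submodule_axioms_def)
qed

lemma submoduleD:
  assumes "submodule N R M"
  shows "N \<subseteq> carrier M" "\<zero>\<^bsub>M\<^esub> \<in> N"
    and "\<And>x y. \<lbrakk>x \<in> N; y \<in> N\<rbrakk> \<Longrightarrow> x \<oplus>\<^bsub>M\<^esub> y \<in> N"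
    and "\<And>a x. \<lbrakk>a \<in> carrier R; x \<in> N\<rbrakk> \<Longrightarrow> a \<odot>\<^bsub>M\<^esub> x \<in> N"
    and "\<And>x y. \<lbrakk>x \<in> N; y \<in> N\<rbrakk> \<Longrightarrow> x \<ominus>\<^bsub>M\<^esub> y \<in> N"
proof -
  interpret submodule N R M by fact
  show *: "N \<subseteq> carrier M" "\<zero>\<^bsub>M\<^esub> \<in> N"
    and add: "\<And>x y. \<lbrakk>x \<in> N; y \<in> N\<rbrakk> \<Longrightarrow> x \<oplus>\<^bsub>M\<^esub> y \<in> N"
    and smult: "\<And>a x. \<lbrakk>a \<in> carrier R; x \<in> N\<rbrakk> \<Longrightarrow> a \<odot>\<^bsub>M\<^esub> x \<in> N"
    using subset one_closed m_closed submodule.smult_closed[OF assms] by auto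
  show "x \<ominus>\<^bsub>M\<^esub> y \<in> N" if "x \<in> N" "y \<in> N" for x y
    using add[OF that(1) smult[of "\<ominus>\<^bsub>R\<^esub> \<one>\<^bsub>R\<^esub>" y]] that *
    by (simp add: smult_minus_one subset_iff a_minus_def)
qed

lemma submodule_carrier: "submodule (carrier M) R M"
  by (rule submoduleI) (auto simp: smult_closed)

lemma submodule_span:
  assumes "S \<subseteq> carrier M"
  shows "submodule (span S) R M"
proof (rule submoduleI)
  show "span S \<subseteq> carrier M"
    using assms submodule_carrier by (rule hull_minimal)
qed (auto simp: hull_def submoduleD)

text \<open>The elements \<open>a s + n\<close> form a submodule containing \<open>s\<close> and
  \<open>F\<close>. Splitting off one generator at a time replaces explicit finite linear
  combinations.\<close>

lemma span_insert:
  assumes "s \<in> carrier M" "F \<subseteq> carrier M" "x \<in> span (insert s F)"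
  obtains a n where "a \<in> carrier R" "n \<in> span F" "x = a \<odot>\<^bsub>M\<^esub> s \<oplus>\<^bsub>M\<^esub> n"
proof -
  define U where "U = {a \<odot>\<^bsub>M\<^esub> s \<oplus>\<^bsub>M\<^esub> n | a n. a \<in> carrier R \<and> n \<in> span F}"
  note N = submoduleD[OF submodule_span[OF assms(2)]]
  have UI: "a \<odot>\<^bsub>M\<^esub> s \<oplus>\<^bsub>M\<^esub> n \<in> U" if "a \<in> carrier R" "n \<in> span F" for a n
    using that by (auto simp: U_def)
  have "submodule U R M"
  proof (rule submoduleI)
    show "U \<subseteq> carrier M"
      using N(1) assms(1) by (auto simp: U_def smult_closed)
    show "\<zero>\<^bsub>M\<^esub> \<in> U"
      using UI[of "\<zero>\<^bsub>R\<^esub>" "\<zero>\<^bsub>M\<^esub>"] N(2) assms(1) by (simp add: smult_l_null)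
  next
    fix x y assume "x \<in> U" "y \<in> U"
    then obtain a b n m where *: "a \<in> carrier R" "b \<in> carrier R" "n \<in> span F" "m \<in> span F"
      "x = a \<odot>\<^bsub>M\<^esub> s \<oplus>\<^bsub>M\<^esub> n" "y = b \<odot>\<^bsub>M\<^esub> s \<oplus>\<^bsub>M\<^esub> m"
      by (auto simp: U_def)
    moreover have "n \<in> carrier M" "m \<in> carrier M"
      using * N(1) by auto
    ultimately have "x \<oplus>\<^bsub>M\<^esub> y = (a \<oplus>\<^bsub>R\<^esub> b) \<odot>\<^bsub>M\<^esub> s \<oplus>\<^bsub>M\<^esub> (n \<oplus>\<^bsub>M\<^esub> m)"
      using assms(1) by (simp add: smult_l_distr smult_closed M.add.m_ac)
    then show "x \<oplus>\<^bsub>M\<^esub> y \<in> U"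
      using UI * N(3) by simp
  next
    fix c x assume c: "c \<in> carrier R" and "x \<in> U"
    then obtain a n where *: "a \<in> carrier R" "n \<in> span F" "x = a \<odot>\<^bsub>M\<^esub> s \<oplus>\<^bsub>M\<^esub> n"
      by (auto simp: U_def)
    moreover have "n \<in> carrier M"
      using * N(1) by auto
    ultimately have "c \<odot>\<^bsub>M\<^esub> x = (c \<otimes>\<^bsub>R\<^esub> a) \<odot>\<^bsub>M\<^esub> s \<oplus>\<^bsub>M\<^esub> c \<odot>\<^bsub>M\<^esub> n"
      using assms(1) c by (simp add: smult_r_distr smult_closed smult_assoc1)
    then show "c \<odot>\<^bsub>M\<^esub> x \<in> U"
      using UI * N(4) c by simp
  qed
  moreover have "insert s F \<subseteq> U"
  proof -
    have "s \<in> U"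
      using UI[of "\<one>\<^bsub>R\<^esub>" "\<zero>\<^bsub>M\<^esub>"] N(2) assms(1) by (simp add: smult_one)
    moreover have "f \<in> U" if "f \<in> F" for f
    proof -
      have "f \<in> carrier M" "f \<in> span F"
        using that assms(2) hull_inc[of f F] by auto
      then show ?thesis
        using UI[of "\<zero>\<^bsub>R\<^esub>" f] assms(1) by (simp add: smult_l_null)
    qed
    ultimately show ?thesis by blast
  qed
  ultimately have "x \<in> U"
    using assms(3) hull_minimal[of "insert s F" U "\<lambda>N. submodule N R M"] by blast
  then show thesis
    using that by (auto simp: U_def)
qed

text \<open>The elements spanned by finite subsets of \<open>S\<close> form a submodule, since two
  finite supports can be united.\<close>

lemma span_finite_support:
  assumes "S \<subseteq> carrier M" "x \<in> span S"
  obtains F where "finite F" "F \<subseteq> S" "x \<in> span F"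
proof -
  define U where "U = {x. \<exists>F. finite F \<and> F \<subseteq> S \<and> x \<in> span F}"
  have sub: "submodule (span F) R M" if "F \<subseteq> S" for F
    using that assms(1) submodule_span by blast
  have "submodule U R M"
  proof (rule submoduleI)
    show "U \<subseteq> carrier M"
      using submoduleD(1)[OF sub] by (auto simp: U_def)
    show "\<zero>\<^bsub>M\<^esub> \<in> U"
      using submoduleD(2)[OF sub[of "{}"]] by (auto simp: U_def)
  next
    fix x y assume "x \<in> U" "y \<in> U"
    then obtain F G where "finite (F \<union> G)" "F \<union> G \<subseteq> S" "x \<in> span F" "y \<in> span G"
      by (auto simp: U_def)
    moreover from this have "x \<oplus>\<^bsub>M\<^esub> y \<in> span (F \<union> G)"
      using submoduleD(3)[OF sub[of "F \<union> G"]] hull_mono[of F "F \<union> G"] hull_mono[of G "F \<union> G"]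
      by (meson Un_upper1 Un_upper2 subsetD)
    ultimately show "x \<oplus>\<^bsub>M\<^esub> y \<in> U"
      unfolding U_def by blast
  next
    fix a x assume "a \<in> carrier R" "x \<in> U"
    then obtain F where "finite F" "F \<subseteq> S" "a \<odot>\<^bsub>M\<^esub> x \<in> span F"
      using submoduleD(4)[OF sub] by (auto simp: U_def)
    then show "a \<odot>\<^bsub>M\<^esub> x \<in> U"
      by (auto simp: U_def)
  qed
  moreover have "S \<subseteq> U"
  proof
    fix x assume "x \<in> S"
    then show "x \<in> U"
      using hull_inc[of x "{x}"] by (auto simp: U_def intro!: exI[of _ "{x}"])
  qed
  ultimately have "x \<in> U"
    using assms(2) hull_minimal[of S U "\<lambda>N. submodule N R M"] by blast
  then show thesis
    using that by (auto simp: U_def)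
qed

text \<open>Each of finitely many generators of \<open>M\<close> involves finitely many elements of
  \<open>S\<close>. Together these elements form a finite generating subset, which by minimality is
  all of \<open>S\<close>.\<close>

lemma minimal_generating_set_finite:
  assumes "finitely_generated R M" "generates R M S" "\<And>T. T \<subset> S \<Longrightarrow> \<not> generates R M T"
  shows "finite S"
proof -
  obtain G where G: "finite G" "G \<subseteq> carrier M" "span G = carrier M"
    using assms(1) by (auto simp: finitely_generated_def generates_def)
  have S: "S \<subseteq> carrier M" "span S = carrier M"
    using assms(2) by (auto simp: generates_def)
  have "\<forall>g\<in>G. \<exists>F. finite F \<and> F \<subseteq> S \<and> g \<in> span F"
    using span_finite_support[OF S(1)] S(2) G(2) by (metis subsetD)
  then obtain F where F: "\<And>g. g \<in> G \<Longrightarrow> finite (F g) \<and> F g \<subseteq> S \<and> g \<in> span (F g)"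
    by metis
  define T where "T = (\<Union>g\<in>G. F g)"
  have T: "finite T" "T \<subseteq> S" "T \<subseteq> carrier M"
    using F G(1) S(1) unfolding T_def by blast+
  have "g \<in> span T" if "g \<in> G" for g
    using F[OF that] hull_mono[of "F g" T] that by (auto simp: T_def)
  then have "span G \<subseteq> span T"
    using submodule_span[OF T(3)] by (intro hull_minimal) auto
  then have "generates R M T"
    using G(3) T(3) submoduleD(1)[OF submodule_span[OF T(3)]] by (auto simp: generates_def)
  then show ?thesis
    using assms(3) T by blast
qed

end

subsection \<open>Graded modules over cancelation monoids\<close>

sublocale graded_ring \<subseteq> A_sum: direct_sum_decomposition A "carrier \<Gamma>" \<A>
  by unfold_locales (rule ring_direct_sum)

sublocale graded_module \<subseteq> M_sum: direct_sum_decomposition M "carrier \<Gamma>" \<M>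
  by unfold_locales (rule module_direct_sum)

locale cancel_graded_module = graded_module \<Gamma> A \<A> M \<M> + monoid_cancel \<Gamma>
  for \<Gamma> :: "('g, 'h) monoid_scheme" (structure)
    and A :: "('a, 'c) ring_scheme" (structure)
    and \<A> :: "'g \<Rightarrow> 'a set"
    and M :: "('a, 'b, 'd) module_scheme" (structure)
    and \<M> :: "'g \<Rightarrow> 'b set"
begin

text \<open>By right cancelation at most one \<open>\<alpha>\<close> satisfies
  \<open>\<alpha> \<delta> = \<gamma>\<close>, so at most one component of \<open>a\<close>
  contributes to degree \<open>\<gamma>\<close> of \<open>a x\<close>.\<close>

lemma component_smult:
  assumes "\<gamma> \<in> carrier \<Gamma>" "\<delta> \<in> carrier \<Gamma>" "x \<in> \<M> \<delta>" "a \<in> carrier A"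
  shows "\<lbrakk>\<alpha> \<in> carrier \<Gamma>; \<alpha> \<otimes>\<^bsub>\<Gamma>\<^esub> \<delta> = \<gamma>\<rbrakk> \<Longrightarrow>
      M_sum.components (a \<odot>\<^bsub>M\<^esub> x) \<gamma> = A_sum.components a \<alpha> \<odot>\<^bsub>M\<^esub> x"
    and "(\<And>\<alpha>. \<alpha> \<in> carrier \<Gamma> \<Longrightarrow> \<alpha> \<otimes>\<^bsub>\<Gamma>\<^esub> \<delta> \<noteq> \<gamma>) \<Longrightarrow>
      M_sum.components (a \<odot>\<^bsub>M\<^esub> x) \<gamma> = \<zero>\<^bsub>M\<^esub>"
proof -
  have x: "x \<in> carrier M"
    using assms M_sum.summand_closed by blast
  have component_homogeneous: "M_sum.components (c \<odot>\<^bsub>M\<^esub> x) \<gamma> = (if \<gamma> = \<alpha> \<otimes>\<^bsub>\<Gamma>\<^esub> \<delta> then c \<odot>\<^bsub>M\<^esub> x else \<zero>\<^bsub>M\<^esub>)"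
    if "\<alpha> \<in> carrier \<Gamma>" "c \<in> \<A> \<alpha>" for \<alpha> c
    using that assms smult_degree by (intro M_sum.component_of_summand) auto
  show "M_sum.components (a \<odot>\<^bsub>M\<^esub> x) \<gamma> = A_sum.components a \<alpha> \<odot>\<^bsub>M\<^esub> x"
    if \<alpha>: "\<alpha> \<in> carrier \<Gamma>" "\<alpha> \<otimes>\<^bsub>\<Gamma>\<^esub> \<delta> = \<gamma>"
    using assms(4)
  proof (induction rule: A_sum.direct_sum_induct)
    case zero
    show ?case
      using \<alpha> x assms(1) by (simp add: smult_l_null M_sum.component_zero A_sum.component_zero)
  next
    case (summand \<beta>)
    then have "\<gamma> = \<beta> \<otimes>\<^bsub>\<Gamma>\<^esub> \<delta> \<longleftrightarrow> \<alpha> = \<beta>"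
      using \<alpha> assms(2) by (metis r_cancel)
    then show ?case
      using component_homogeneous[OF summand A_sum.component_in_summand[OF summand assms(4)]]
        A_sum.component_of_summand[OF summand \<alpha>(1) A_sum.component_in_summand[OF summand assms(4)]] x
      by (simp add: smult_l_null)
  next
    case (add b c)
    then show ?case
      using \<alpha> x assms(1)
      by (simp add: smult_l_distr smult_closed M_sum.component_add A_sum.component_add A_sum.component_closed)
  qed
  show "M_sum.components (a \<odot>\<^bsub>M\<^esub> x) \<gamma> = \<zero>\<^bsub>M\<^esub>"
    if no: "\<And>\<alpha>. \<alpha> \<in> carrier \<Gamma> \<Longrightarrow> \<alpha> \<otimes>\<^bsub>\<Gamma>\<^esub> \<delta> \<noteq> \<gamma>"
    using assms(4)
  proof (induction rule: A_sum.direct_sum_induct)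
    case zero
    show ?case
      using x assms(1) by (simp add: smult_l_null M_sum.component_zero)
  next
    case (summand \<beta>)
    then show ?case
      using component_homogeneous[OF summand A_sum.component_in_summand[OF summand assms(4)]]
        no[OF summand] by simp
  next
    case (add b c)
    then show ?case
      using x assms(1) by (simp add: smult_l_distr smult_closed M_sum.component_add)
  qed
qed

definition homogeneous_set :: "'b set \<Rightarrow> bool" where
  "homogeneous_set F \<longleftrightarrow> (\<forall>x\<in>F. \<exists>\<gamma>\<in>carrier \<Gamma>. x \<in> \<M> \<gamma>)"

lemma homogeneous_set_closed: "homogeneous_set F \<Longrightarrow> F \<subseteq> carrier M"
  using M_sum.summand_closed by (auto simp: homogeneous_set_def)

text \<open>A submodule generated by homogeneous elements is graded: the elements with all
  components in \<open>span F\<close> form a submodule containing \<open>F\<close>.\<close>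

lemma component_in_span:
  assumes F: "homogeneous_set F" and "x \<in> span F" "\<gamma> \<in> carrier \<Gamma>"
  shows "M_sum.components x \<gamma> \<in> span F"
proof -
  note N = submoduleD[OF submodule_span[OF homogeneous_set_closed[OF F]]]
  define U where "U = {x \<in> carrier M. \<forall>\<gamma>\<in>carrier \<Gamma>. M_sum.components x \<gamma> \<in> span F}"
  have "submodule U A M"
  proof (rule submoduleI)
    show "U \<subseteq> carrier M" by (auto simp: U_def)
    show "\<zero>\<^bsub>M\<^esub> \<in> U" using N(2) by (auto simp: U_def M_sum.component_zero)
    show "x \<oplus>\<^bsub>M\<^esub> y \<in> U" if "x \<in> U" "y \<in> U" for x y
      using that N(3) by (auto simp: U_def M_sum.component_add)
    fix a x assume a: "a \<in> carrier A" and "x \<in> U"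
    then have x: "x \<in> carrier M" "\<And>\<gamma>. \<gamma> \<in> carrier \<Gamma> \<Longrightarrow> M_sum.components x \<gamma> \<in> span F"
      by (auto simp: U_def)
    \<comment> \<open>Induction over the components of \<open>x\<close> reduces to a homogeneous
      factor; there the component of the product is zero or a scalar multiple of a component of
      \<open>x\<close>.\<close>
    have "M_sum.components (a \<odot>\<^bsub>M\<^esub> x) \<gamma> \<in> span F" if \<gamma>: "\<gamma> \<in> carrier \<Gamma>" for \<gamma>
      using x(1)
    proof (induction rule: M_sum.direct_sum_induct)
      case zero
      show ?case using a \<gamma> N(2) by (simp add: smult_r_null M_sum.component_zero)
    next
      case (summand \<delta>)
      note y = component_smult[OF \<gamma> summand M_sum.component_in_summand[OF summand x(1)] a]
      show ?case
      proof (cases "\<exists>\<alpha>\<in>carrier \<Gamma>. \<alpha> \<otimes>\<^bsub>\<Gamma>\<^esub> \<delta> = \<gamma>")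
        case True
        then obtain \<alpha> where \<alpha>: "\<alpha> \<in> carrier \<Gamma>" "\<alpha> \<otimes>\<^bsub>\<Gamma>\<^esub> \<delta> = \<gamma>" by blast
        show ?thesis
          unfolding y(1)[OF \<alpha>] using N(4) x(2)[OF summand] A_sum.component_closed[OF \<alpha>(1) a] by simp
      next
        case False
        then show ?thesis using y(2) N(2) by simp
      qed
    next
      case (add y z)
      then show ?case
        using a \<gamma> N(3) by (simp add: smult_r_distr smult_closed M_sum.component_add)
    qed
    then show "a \<odot>\<^bsub>M\<^esub> x \<in> U"
      using a x(1) by (simp add: U_def smult_closed)
  qed
  moreover have "F \<subseteq> U"
  proof
    fix x assume x: "x \<in> F"
    then obtain \<delta> where "\<delta> \<in> carrier \<Gamma>" "x \<in> \<M> \<delta>"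
      using F by (auto simp: homogeneous_set_def)
    moreover have "x \<in> span F"
      using x by (rule hull_inc)
    ultimately show "x \<in> U"
      using N(1,2) M_sum.component_of_summand[of \<delta> _ x] by (auto simp: U_def)
  qed
  ultimately have "span F \<subseteq> U"
    by (intro hull_minimal)
  then show ?thesis
    using assms by (auto simp: U_def)
qed

text \<open>Take the component of degree \<open>\<gamma>\<close> in \<open>x = a s + n\<close>:
  \<open>n\<close> stays in \<open>span F\<close>, and \<open>a\<close> shrinks to one homogeneous
  component, or to zero if no degree carries \<open>\<delta>\<close> to
  \<open>\<gamma>\<close>.\<close>

lemma homogeneous_span_insert:
  assumes \<gamma>: "\<gamma> \<in> carrier \<Gamma>" "x \<in> \<M> \<gamma>" and \<delta>: "\<delta> \<in> carrier \<Gamma>" "s \<in> \<M> \<delta>"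
    and F: "homogeneous_set F" and x: "x \<in> span (insert s F)"
  obtains a n where "a \<in> carrier A" "n \<in> span F" "n \<in> \<M> \<gamma>" "x = a \<odot>\<^bsub>M\<^esub> s \<oplus>\<^bsub>M\<^esub> n"
    "a = \<zero>\<^bsub>A\<^esub> \<or> (\<exists>\<alpha>\<in>carrier \<Gamma>. a \<in> \<A> \<alpha> \<and> \<alpha> \<otimes>\<^bsub>\<Gamma>\<^esub> \<delta> = \<gamma>)"
proof -
  have s: "s \<in> carrier M"
    using \<delta> M_sum.summand_closed by blast
  note N = submoduleD[OF submodule_span[OF homogeneous_set_closed[OF F]]]
  obtain a n where an: "a \<in> carrier A" "n \<in> span F" "x = a \<odot>\<^bsub>M\<^esub> s \<oplus>\<^bsub>M\<^esub> n"
    using span_insert[OF s homogeneous_set_closed[OF F] x] .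
  have n: "n \<in> carrier M"
    using an N(1) by blast
  define m where "m = M_sum.components n \<gamma>"
  have m: "m \<in> span F" "m \<in> \<M> \<gamma>"
    using component_in_span[OF F an(2) \<gamma>(1)] M_sum.component_in_summand[OF \<gamma>(1) n]
    by (auto simp: m_def)
  have "x = M_sum.components x \<gamma>"
    using M_sum.component_of_summand[of \<gamma> \<gamma> x] \<gamma> by simp
  then have x_eq: "x = M_sum.components (a \<odot>\<^bsub>M\<^esub> s) \<gamma> \<oplus>\<^bsub>M\<^esub> m"
    unfolding an(3) m_def using an(1) s n \<gamma>(1) by (simp add: smult_closed M_sum.component_add)
  note c = component_smult[OF \<gamma>(1) \<delta> an(1)]
  show thesis
  proof (cases "\<exists>\<alpha>\<in>carrier \<Gamma>. \<alpha> \<otimes>\<^bsub>\<Gamma>\<^esub> \<delta> = \<gamma>")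
    case True
    then obtain \<alpha> where \<alpha>: "\<alpha> \<in> carrier \<Gamma>" "\<alpha> \<otimes>\<^bsub>\<Gamma>\<^esub> \<delta> = \<gamma>" by blast
    show thesis
    proof (rule that)
      show "A_sum.components a \<alpha> = \<zero>\<^bsub>A\<^esub> \<or>
          (\<exists>\<alpha>'\<in>carrier \<Gamma>. A_sum.components a \<alpha> \<in> \<A> \<alpha>' \<and> \<alpha>' \<otimes>\<^bsub>\<Gamma>\<^esub> \<delta> = \<gamma>)"
        using \<alpha> an(1) A_sum.component_in_summand by blast
    qed (use m x_eq c(1)[OF \<alpha>] \<alpha> an(1) A_sum.component_closed in auto)
  next
    case False
    then show thesis
      using that[of "\<zero>\<^bsub>A\<^esub>" m] m x_eq c(2) s by (simp add: smult_l_null)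
  qed
qed

end

subsection \<open>Homogeneous exchange\<close>

text \<open>The degree \<open>e\<close> subring shares the operations of \<open>A\<close>, so its
  maximal left ideal can be described inside \<open>A\<close>.\<close>

lemma (in graded_local_ring) exists_noninvertibles_of_degree_one:
  obtains J where "J \<subseteq> \<A> \<one>\<^bsub>\<Gamma>\<^esub>" "\<zero>\<^bsub>A\<^esub> \<in> J" "\<one>\<^bsub>A\<^esub> \<in> \<A> \<one>\<^bsub>\<Gamma>\<^esub> - J"
    "\<And>x y. \<lbrakk>x \<in> J; y \<in> J\<rbrakk> \<Longrightarrow> x \<oplus>\<^bsub>A\<^esub> y \<in> J"
    "\<And>x. x \<in> \<A> \<one>\<^bsub>\<Gamma>\<^esub> - J \<Longrightarrow> \<exists>y\<in>\<A> \<one>\<^bsub>\<Gamma>\<^esub>. y \<otimes>\<^bsub>A\<^esub> x = \<one>\<^bsub>A\<^esub>"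
proof -
  interpret A1: local_ring "A\<lparr>carrier := \<A> \<one>\<^bsub>\<Gamma>\<^esub>\<rparr>"
    by (rule local_ring_degree_one)
  obtain J where J: "left_ideal J (A\<lparr>carrier := \<A> \<one>\<^bsub>\<Gamma>\<^esub>\<rparr>)" "\<one>\<^bsub>A\<^esub> \<notin> J"
    "\<And>x. \<lbrakk>x \<in> \<A> \<one>\<^bsub>\<Gamma>\<^esub>; x \<notin> J\<rbrakk> \<Longrightarrow> \<exists>y\<in>\<A> \<one>\<^bsub>\<Gamma>\<^esub>. y \<otimes>\<^bsub>A\<^esub> x = \<one>\<^bsub>A\<^esub>"
    using A1.exists_left_ideal_of_noninvertibles by auto
  interpret J: left_ideal J "A\<lparr>carrier := \<A> \<one>\<^bsub>\<Gamma>\<^esub>\<rparr>"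
    by (rule J)
  show thesis
    using that[of J] J J.a_subset J.zero_closed J.a_closed A1.one_closed by auto
qed

locale cancel_graded_local_module =
  cancel_graded_module \<Gamma> A \<A> M \<M> + graded_local_ring \<Gamma> A \<A>
  for \<Gamma> :: "('g, 'h) monoid_scheme" (structure)
    and A :: "('a, 'c) ring_scheme" (structure)
    and \<A> :: "'g \<Rightarrow> 'a set"
    and M :: "('a, 'b, 'd) module_scheme" (structure)
    and \<M> :: "'g \<Rightarrow> 'b set"
begin

text \<open>In the application \<open>F\<close> is a minimal generating set without
  \<open>s\<close>. Then \<open>t \<notin> span F\<close> ensures that the element given up lies
  outside \<open>F\<close>, and the last two equations compare its degree with that of
  \<open>s\<close>.\<close>

lemma homogeneous_exchange:
  assumes \<delta>: "\<delta> \<in> carrier \<Gamma>" "s \<in> \<M> \<delta>" and F: "homogeneous_set F"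
    and s: "s \<notin> span F" "span (insert s F) = carrier M"
    and T: "finite T" "homogeneous_set T" "span T = carrier M"
  obtains t \<tau> \<alpha> \<beta> where "t \<in> T" "t \<notin> span F" "t \<in> span (insert s (T - {t}))"
    "\<tau> \<in> carrier \<Gamma>" "t \<in> \<M> \<tau>" "\<alpha> \<in> carrier \<Gamma>" "\<beta> \<in> carrier \<Gamma>"
    "\<alpha> \<otimes>\<^bsub>\<Gamma>\<^esub> \<beta> = \<one>\<^bsub>\<Gamma>\<^esub>" "\<alpha> \<otimes>\<^bsub>\<Gamma>\<^esub> \<tau> = \<delta>"
proof -
  obtain J where J: "J \<subseteq> \<A> \<one>\<^bsub>\<Gamma>\<^esub>" "\<zero>\<^bsub>A\<^esub> \<in> J" "\<one>\<^bsub>A\<^esub> \<in> \<A> \<one>\<^bsub>\<Gamma>\<^esub> - J"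
    "\<And>x y. \<lbrakk>x \<in> J; y \<in> J\<rbrakk> \<Longrightarrow> x \<oplus>\<^bsub>A\<^esub> y \<in> J"
    and inv: "\<And>x. x \<in> \<A> \<one>\<^bsub>\<Gamma>\<^esub> - J \<Longrightarrow> \<exists>y\<in>\<A> \<one>\<^bsub>\<Gamma>\<^esub>. y \<otimes>\<^bsub>A\<^esub> x = \<one>\<^bsub>A\<^esub>"
    by (rule exists_noninvertibles_of_degree_one) blast
  have A1: "x \<in> carrier A" if "x \<in> \<A> \<one>\<^bsub>\<Gamma>\<^esub>" for x
    using that A_sum.summand_closed by blast
  \<comment> \<open>If \<open>1 - j\<close> were in \<open>J\<close>, then so would be
    \<open>1 = (1 - j) + j\<close>.\<close>
  have one_minus: "\<exists>y\<in>carrier A. y \<otimes>\<^bsub>A\<^esub> (\<one>\<^bsub>A\<^esub> \<ominus>\<^bsub>A\<^esub> j) = \<one>\<^bsub>A\<^esub>" if j: "j \<in> J" for j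
  proof -
    have jA: "j \<in> carrier A" "j \<in> \<A> \<one>\<^bsub>\<Gamma>\<^esub>"
      using j J(1) A1 by auto
    interpret H: additive_subgroup "\<A> \<one>\<^bsub>\<Gamma>\<^esub>" A
      by (rule A_sum.summand_subgroup) simp
    have "\<one>\<^bsub>A\<^esub> \<ominus>\<^bsub>A\<^esub> j \<in> \<A> \<one>\<^bsub>\<Gamma>\<^esub>"
      using J(3) jA A.is_abelian_group by (simp add: a_minus_def H.a_inv_closed)
    moreover have "(\<one>\<^bsub>A\<^esub> \<ominus>\<^bsub>A\<^esub> j) \<oplus>\<^bsub>A\<^esub> j = \<one>\<^bsub>A\<^esub>"
      using jA by (simp add: a_minus_def A.a_assoc A.l_neg)
    then have "\<one>\<^bsub>A\<^esub> \<ominus>\<^bsub>A\<^esub> j \<notin> J"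
      using J(3) J(4)[OF _ j] by force
    ultimately show ?thesis
      using inv A1 by blast
  qed
  have F': "F \<subseteq> carrier M" and T': "T \<subseteq> carrier M"
    using F T homogeneous_set_closed by auto
  note N = submoduleD[OF submodule_span[OF F']]
  have sM: "s \<in> carrier M"
    using \<delta> M_sum.summand_closed by blast
  \<comment> \<open>\<open>K\<close> collects what is negligible: the multiples of \<open>s\<close>
    by \<open>J\<close>, modulo \<open>span F\<close>. It is closed under addition, so negligible
    terms can be absorbed one by one.\<close>
  define K where "K = {j \<odot>\<^bsub>M\<^esub> s \<oplus>\<^bsub>M\<^esub> n | j n. j \<in> J \<and> n \<in> span F}"
  have K_add: "x \<oplus>\<^bsub>M\<^esub> y \<in> K" if "x \<in> K" "y \<in> K" for x y
  proof -
    obtain i j n m where *: "i \<in> J" "j \<in> J" "n \<in> span F" "m \<in> span F"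
      "x = i \<odot>\<^bsub>M\<^esub> s \<oplus>\<^bsub>M\<^esub> n" "y = j \<odot>\<^bsub>M\<^esub> s \<oplus>\<^bsub>M\<^esub> m"
      using \<open>x \<in> K\<close> \<open>y \<in> K\<close> unfolding K_def by blast
    moreover have "i \<in> carrier A" "j \<in> carrier A" "n \<in> carrier M" "m \<in> carrier M"
      using * J(1) A1 N(1) by auto
    ultimately have "x \<oplus>\<^bsub>M\<^esub> y = (i \<oplus>\<^bsub>A\<^esub> j) \<odot>\<^bsub>M\<^esub> s \<oplus>\<^bsub>M\<^esub> (n \<oplus>\<^bsub>M\<^esub> m)"
      using sM by (simp add: smult_l_distr smult_closed M.add.m_ac)
    then show ?thesis
      using J(4) N(3) * unfolding K_def by blast
  qed
  have span_K: "x \<in> K" if "x \<in> span F" for x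
  proof -
    have "x = \<zero>\<^bsub>A\<^esub> \<odot>\<^bsub>M\<^esub> s \<oplus>\<^bsub>M\<^esub> x"
      using that N(1) sM by (auto simp: smult_l_null)
    then show ?thesis
      using that J(2) unfolding K_def by blast
  qed
  \<comment> \<open>From \<open>s = j s + n\<close> follows \<open>(1 - j) s = n\<close>, and a left
    inverse of \<open>1 - j\<close> would put \<open>s\<close> into \<open>span F\<close>.\<close>
  have "s \<notin> K"
  proof
    assume "s \<in> K"
    then obtain j n where j: "j \<in> J" and n: "n \<in> span F" and s_eq: "s = j \<odot>\<^bsub>M\<^esub> s \<oplus>\<^bsub>M\<^esub> n"
      unfolding K_def by blast
    have jA: "j \<in> carrier A" and nM: "n \<in> carrier M"
      using j J(1) A1 n N(1) by auto
    obtain y where y: "y \<in> carrier A" "y \<otimes>\<^bsub>A\<^esub> (\<one>\<^bsub>A\<^esub> \<ominus>\<^bsub>A\<^esub> j) = \<one>\<^bsub>A\<^esub>"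
      using one_minus[OF j] by blast
    have "n = \<ominus>\<^bsub>M\<^esub> (j \<odot>\<^bsub>M\<^esub> s) \<oplus>\<^bsub>M\<^esub> s"
      using s_eq jA nM sM by (metis M.r_neg1 smult_closed)
    also have "\<ominus>\<^bsub>M\<^esub> (j \<odot>\<^bsub>M\<^esub> s) = (\<ominus>\<^bsub>A\<^esub> j) \<odot>\<^bsub>M\<^esub> s"
      using jA sM smult_assoc1[of "\<ominus>\<^bsub>A\<^esub> \<one>\<^bsub>A\<^esub>" j s] smult_minus_one[of "j \<odot>\<^bsub>M\<^esub> s"]
      by (simp add: smult_closed A.l_minus)
    also have "\<dots> \<oplus>\<^bsub>M\<^esub> s = (\<one>\<^bsub>A\<^esub> \<ominus>\<^bsub>A\<^esub> j) \<odot>\<^bsub>M\<^esub> s"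
      using jA sM by (simp add: a_minus_def smult_l_distr smult_one smult_closed M.a_comm)
    finally have "y \<odot>\<^bsub>M\<^esub> n = s"
      using y jA sM smult_assoc1[of y "\<one>\<^bsub>A\<^esub> \<ominus>\<^bsub>A\<^esub> j" s] by (simp add: smult_one)
    then show False
      using N(4)[OF y(1) n] s(1) by simp
  qed
  \<comment> \<open>A generator \<open>t\<close> is good if its coefficient \<open>a\<close> in \<open>x\<close> times the coefficient \<open>b\<close> of \<open>s\<close> in \<open>t\<close>
    is invertible. Otherwise all terms \<open>a t\<close> lie in \<open>K = J s + span F\<close>, hence so does \<open>x\<close>.\<close>
  define good where "good = (\<lambda>x t G. t \<in> T \<and> t \<notin> span F \<and> (\<exists>\<tau> \<alpha> \<beta> a b m n.
      \<tau> \<in> carrier \<Gamma> \<and> t \<in> \<M> \<tau> \<and> \<alpha> \<in> carrier \<Gamma> \<and> \<beta> \<in> carrier \<Gamma> \<and> \<alpha> \<otimes>\<^bsub>\<Gamma>\<^esub> \<tau> = \<delta> \<and> \<beta> \<otimes>\<^bsub>\<Gamma>\<^esub> \<delta> = \<tau> \<and>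
      a \<in> \<A> \<alpha> \<and> b \<in> \<A> \<beta> \<and> a \<otimes>\<^bsub>A\<^esub> b \<notin> J \<and> m \<in> span G \<and> x = a \<odot>\<^bsub>M\<^esub> t \<oplus>\<^bsub>M\<^esub> m))"
  \<comment> \<open>Here \<open>\<alpha> \<beta>\<close> fixes \<open>\<delta>\<close> and
    \<open>\<beta> \<alpha>\<close> fixes \<open>\<tau>\<close>; right cancelation makes both equal
    to \<open>e\<close>. Both orders are used for the inverse of \<open>a\<close> below.\<close>
  have degrees: "\<alpha> \<otimes>\<^bsub>\<Gamma>\<^esub> \<beta> = \<one>\<^bsub>\<Gamma>\<^esub>" "\<beta> \<otimes>\<^bsub>\<Gamma>\<^esub> \<alpha> = \<one>\<^bsub>\<Gamma>\<^esub>"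
    if "\<tau> \<in> carrier \<Gamma>" "\<alpha> \<in> carrier \<Gamma>" "\<beta> \<in> carrier \<Gamma>" "\<alpha> \<otimes>\<^bsub>\<Gamma>\<^esub> \<tau> = \<delta>" "\<beta> \<otimes>\<^bsub>\<Gamma>\<^esub> \<delta> = \<tau>" for \<tau> \<alpha> \<beta>
  proof -
    have "(\<alpha> \<otimes>\<^bsub>\<Gamma>\<^esub> \<beta>) \<otimes>\<^bsub>\<Gamma>\<^esub> \<delta> = \<one>\<^bsub>\<Gamma>\<^esub> \<otimes>\<^bsub>\<Gamma>\<^esub> \<delta>"
      using that \<delta>(1) by (simp add: \<Gamma>.m_assoc)
    then show "\<alpha> \<otimes>\<^bsub>\<Gamma>\<^esub> \<beta> = \<one>\<^bsub>\<Gamma>\<^esub>"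
      by (rule r_cancel) (use that \<delta>(1) in auto)
    have "(\<beta> \<otimes>\<^bsub>\<Gamma>\<^esub> \<alpha>) \<otimes>\<^bsub>\<Gamma>\<^esub> \<tau> = \<one>\<^bsub>\<Gamma>\<^esub> \<otimes>\<^bsub>\<Gamma>\<^esub> \<tau>"
      using that \<delta>(1) by (simp add: \<Gamma>.m_assoc)
    then show "\<beta> \<otimes>\<^bsub>\<Gamma>\<^esub> \<alpha> = \<one>\<^bsub>\<Gamma>\<^esub>"
      by (rule r_cancel) (use that \<delta>(1) in auto)
  qed
  \<comment> \<open>Generators are split off one at a time, with \<open>x\<close> arbitrary because
    the induction hypothesis is applied to the remainder. The case of interest is
    \<open>G = T\<close>, \<open>x = s\<close>.\<close>
  have "x \<in> K \<or> (\<exists>t\<in>G. good x t (G - {t}))"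
    if "finite G" "G \<subseteq> T" "x \<in> \<M> \<delta>" "x \<in> span G" for x G
    using that
  proof (induction arbitrary: x)
    case empty
    then show ?case
      using hull_mono[of "{}" F "\<lambda>N. submodule N A M"] span_K by auto
  next
    case (insert t G)
    obtain \<tau> where \<tau>: "\<tau> \<in> carrier \<Gamma>" "t \<in> \<M> \<tau>"
      using insert.prems T(2) by (auto simp: homogeneous_set_def)
    have G: "homogeneous_set G"
      using insert.prems T(2) by (auto simp: homogeneous_set_def)
    have tM: "t \<in> carrier M"
      using \<tau> M_sum.summand_closed by blast
    obtain a y where a: "a \<in> carrier A" and y: "y \<in> span G" "y \<in> \<M> \<delta>"
      and x: "x = a \<odot>\<^bsub>M\<^esub> t \<oplus>\<^bsub>M\<^esub> y"
      and \<alpha>: "a = \<zero>\<^bsub>A\<^esub> \<or> (\<exists>\<alpha>\<in>carrier \<Gamma>. a \<in> \<A> \<alpha> \<and> \<alpha> \<otimes>\<^bsub>\<Gamma>\<^esub> \<tau> = \<delta>)"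
      using homogeneous_span_insert[OF \<delta>(1) insert.prems(2) \<tau> G insert.prems(3)] .
    show ?case
    proof (cases "a \<odot>\<^bsub>M\<^esub> t \<in> K")
      case True
      from insert.IH[OF _ y(2,1)] insert.prems(1) consider "y \<in> K" | t' where "t' \<in> G" "good y t' (G - {t'})"
        by blast
      then show ?thesis
      proof cases
        case 1
        then show ?thesis using K_add True x by blast
      next
        case 2
        then obtain \<tau>' \<alpha>' \<beta>' a' b' m where *: "\<tau>' \<in> carrier \<Gamma>" "t' \<in> \<M> \<tau>'" "\<alpha>' \<in> carrier \<Gamma>" "\<beta>' \<in> carrier \<Gamma>"
          "\<alpha>' \<otimes>\<^bsub>\<Gamma>\<^esub> \<tau>' = \<delta>" "\<beta>' \<otimes>\<^bsub>\<Gamma>\<^esub> \<delta> = \<tau>'" "a' \<in> \<A> \<alpha>'" "b' \<in> \<A> \<beta>'" "a' \<otimes>\<^bsub>A\<^esub> b' \<notin> J"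
          "m \<in> span (G - {t'})" "y = a' \<odot>\<^bsub>M\<^esub> t' \<oplus>\<^bsub>M\<^esub> m" "t' \<in> T" "t' \<notin> span F"
          unfolding good_def by blast
        \<comment> \<open>The good term \<open>t'\<close> of \<open>y\<close> stays good for
          \<open>x\<close>: the term \<open>a t\<close> joins the remainder, where \<open>t\<close>
          is allowed since \<open>t \<notin> G\<close> gives \<open>t \<noteq> t'\<close>.\<close>
        define G' where "G' = insert t G - {t'}"
        have G': "G' \<subseteq> carrier M" "t \<in> G'" "G - {t'} \<subseteq> G'"
          using insert.prems(1) T' 2 insert.hyps by (auto simp: G'_def)
        note N' = submoduleD[OF submodule_span[OF G'(1)]]
        have m: "m \<in> span G'"
          using *(10) hull_mono[OF G'(3)] by blast
        then have "a \<odot>\<^bsub>M\<^esub> t \<oplus>\<^bsub>M\<^esub> m \<in> span G'"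
          using N'(3,4) a hull_inc[OF G'(2)] by blast
        moreover have "x = a' \<odot>\<^bsub>M\<^esub> t' \<oplus>\<^bsub>M\<^esub> (a \<odot>\<^bsub>M\<^esub> t \<oplus>\<^bsub>M\<^esub> m)"
        proof -
          have "m \<in> carrier M" "a' \<in> carrier A" "t' \<in> carrier M"
            using m N'(1) * A_sum.summand_closed T' by auto
          then show ?thesis
            using x *(11) a tM by (simp add: smult_closed M.add.m_ac)
        qed
        ultimately have "good x t' G'"
          using * unfolding good_def by blast
        then show ?thesis
          using 2 by (auto simp: G'_def)
      qed
    next
      case False
      \<comment> \<open>As \<open>K\<close> contains \<open>span F\<close>, the assumption
        \<open>a t \<notin> K\<close> excludes \<open>t \<in> span F\<close> and
        \<open>a = 0\<close>; the former in turn excludes \<open>b = 0\<close>. So both coefficients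
        have a degree.\<close>
      have "t \<notin> span F"
        using False span_K N(4) a by blast
      have "a \<noteq> \<zero>\<^bsub>A\<^esub>"
        using False span_K N(2) tM by (auto simp: smult_l_null)
      then obtain \<alpha> where \<alpha>: "\<alpha> \<in> carrier \<Gamma>" "a \<in> \<A> \<alpha>" "\<alpha> \<otimes>\<^bsub>\<Gamma>\<^esub> \<tau> = \<delta>"
        using \<alpha> by blast
      have "t \<in> span (insert s F)"
        using s tM by simp
      then obtain b n where b: "b \<in> carrier A" and n: "n \<in> span F" "n \<in> \<M> \<tau>"
        and t: "t = b \<odot>\<^bsub>M\<^esub> s \<oplus>\<^bsub>M\<^esub> n"
        and \<beta>: "b = \<zero>\<^bsub>A\<^esub> \<or> (\<exists>\<beta>\<in>carrier \<Gamma>. b \<in> \<A> \<beta> \<and> \<beta> \<otimes>\<^bsub>\<Gamma>\<^esub> \<delta> = \<tau>)"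
        using homogeneous_span_insert[OF \<tau> \<delta> F] by blast
      have nM: "n \<in> carrier M"
        using n N(1) by auto
      have "b \<noteq> \<zero>\<^bsub>A\<^esub>"
        using \<open>t \<notin> span F\<close> t n(1) nM sM by (auto simp: smult_l_null)
      then obtain \<beta> where \<beta>: "\<beta> \<in> carrier \<Gamma>" "b \<in> \<A> \<beta>" "\<beta> \<otimes>\<^bsub>\<Gamma>\<^esub> \<delta> = \<tau>"
        using \<beta> by blast
      \<comment> \<open>Substituting \<open>t = b s + n\<close> shows that
        \<open>a b \<in> J\<close> would put \<open>a t\<close> into \<open>K\<close>.\<close>
      have "a \<odot>\<^bsub>M\<^esub> t = (a \<otimes>\<^bsub>A\<^esub> b) \<odot>\<^bsub>M\<^esub> s \<oplus>\<^bsub>M\<^esub> a \<odot>\<^bsub>M\<^esub> n"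
        using t a b sM nM by (simp add: smult_r_distr smult_assoc1 smult_closed)
      moreover have "a \<odot>\<^bsub>M\<^esub> n \<in> span F"
        using N(4) a n(1) by blast
      ultimately have "a \<otimes>\<^bsub>A\<^esub> b \<notin> J"
        using False unfolding K_def by blast
      then have "good x t G"
        using \<tau> \<alpha> \<beta> x y insert.prems(1) \<open>t \<notin> span F\<close> unfolding good_def by blast
      moreover have "insert t G - {t} = G"
        using insert.hyps by simp
      ultimately show ?thesis
        by (metis insertI1)
    qed
  qed
  then obtain t where t: "t \<in> T" "good s t (T - {t})"
    using T(1,3) sM \<delta>(2) \<open>s \<notin> K\<close> by blast
  then obtain \<tau> \<alpha> \<beta> a b m where *: "\<tau> \<in> carrier \<Gamma>" "t \<in> \<M> \<tau>" "\<alpha> \<in> carrier \<Gamma>" "\<beta> \<in> carrier \<Gamma>"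
    "\<alpha> \<otimes>\<^bsub>\<Gamma>\<^esub> \<tau> = \<delta>" "\<beta> \<otimes>\<^bsub>\<Gamma>\<^esub> \<delta> = \<tau>" "a \<in> \<A> \<alpha>" "b \<in> \<A> \<beta>" "a \<otimes>\<^bsub>A\<^esub> b \<notin> J"
    "m \<in> span (T - {t})" "s = a \<odot>\<^bsub>M\<^esub> t \<oplus>\<^bsub>M\<^esub> m" "t \<notin> span F"
    unfolding good_def by blast
  have ab: "a \<in> carrier A" "b \<in> carrier A"
    using * A_sum.summand_closed by auto
  have deg: "\<alpha> \<otimes>\<^bsub>\<Gamma>\<^esub> \<beta> = \<one>\<^bsub>\<Gamma>\<^esub>" "\<beta> \<otimes>\<^bsub>\<Gamma>\<^esub> \<alpha> = \<one>\<^bsub>\<Gamma>\<^esub>"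
    using degrees * by blast+
  \<comment> \<open>A left inverse of \<open>a b\<close> yields none of \<open>a\<close> directly.
    Locality is used a second time, for a product that ends in \<open>a\<close>.\<close>
  have "\<exists>c\<in>carrier A. c \<otimes>\<^bsub>A\<^esub> a = \<one>\<^bsub>A\<^esub>"
  proof -
    have "a \<otimes>\<^bsub>A\<^esub> b \<in> \<A> \<one>\<^bsub>\<Gamma>\<^esub>"
      using mult_degree[OF *(3,4,7,8)] deg by simp
    then obtain v where v: "v \<in> \<A> \<one>\<^bsub>\<Gamma>\<^esub>" "v \<otimes>\<^bsub>A\<^esub> (a \<otimes>\<^bsub>A\<^esub> b) = \<one>\<^bsub>A\<^esub>"
      using inv *(9) by blast
    have vA: "v \<in> carrier A"
      using v A1 by blast
    \<comment> \<open>Since \<open>v a b = \<one>\<close>, \<open>(\<one> - f) b = \<zero>\<close>; hence \<open>\<one> - f\<close> is not invertible and \<open>f\<close> is.\<close>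
    define f where "f = b \<otimes>\<^bsub>A\<^esub> v \<otimes>\<^bsub>A\<^esub> a"
    \<comment> \<open>The degree of \<open>f\<close> is \<open>\<beta> \<alpha>\<close>, so
      \<open>f\<close> lies in the local ring because this order of the product is also
      \<open>e\<close>.\<close>
    have "b \<otimes>\<^bsub>A\<^esub> v \<in> \<A> \<beta>"
      using mult_degree[OF *(4) \<Gamma>.one_closed *(8) v(1)] *(4) by simp
    then have f: "f \<in> \<A> \<one>\<^bsub>\<Gamma>\<^esub>"
      using mult_degree[OF *(4,3) _ *(7)] deg by (simp add: f_def)
    have "f \<notin> J"
    proof
      assume "f \<in> J"
      then obtain w where w: "w \<in> carrier A" "w \<otimes>\<^bsub>A\<^esub> (\<one>\<^bsub>A\<^esub> \<ominus>\<^bsub>A\<^esub> f) = \<one>\<^bsub>A\<^esub>"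
        using one_minus by blast
      have "(\<one>\<^bsub>A\<^esub> \<ominus>\<^bsub>A\<^esub> f) \<otimes>\<^bsub>A\<^esub> b = b \<ominus>\<^bsub>A\<^esub> b \<otimes>\<^bsub>A\<^esub> (v \<otimes>\<^bsub>A\<^esub> (a \<otimes>\<^bsub>A\<^esub> b))"
        using ab vA by (simp add: f_def a_minus_def A.l_distr A.l_minus A.m_assoc)
      also have "\<dots> = \<zero>\<^bsub>A\<^esub>"
        using ab v by (simp add: A.r_neg a_minus_def)
      finally have "b = \<zero>\<^bsub>A\<^esub>"
        using w ab f A1 A.m_assoc[of w "\<one>\<^bsub>A\<^esub> \<ominus>\<^bsub>A\<^esub> f" b] by simp
      then show False
        using *(9) ab J(2) by simp
    qed
    then obtain w where w: "w \<in> \<A> \<one>\<^bsub>\<Gamma>\<^esub>" "w \<otimes>\<^bsub>A\<^esub> f = \<one>\<^bsub>A\<^esub>"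
      using inv f by blast
    then have "(w \<otimes>\<^bsub>A\<^esub> (b \<otimes>\<^bsub>A\<^esub> v)) \<otimes>\<^bsub>A\<^esub> a = \<one>\<^bsub>A\<^esub>"
      using A1 ab vA by (simp add: f_def A.m_assoc)
    then show ?thesis
      using A1 w ab vA by (metis A.m_closed)
  qed
  then obtain c where c: "c \<in> carrier A" "c \<otimes>\<^bsub>A\<^esub> a = \<one>\<^bsub>A\<^esub>"
    by blast
  have tM: "t \<in> carrier M"
    using t T' by blast
  have G: "insert s (T - {t}) \<subseteq> carrier M" "T - {t} \<subseteq> insert s (T - {t})"
    using sM T' by auto
  note N' = submoduleD[OF submodule_span[OF G(1)]]
  have m: "m \<in> span (insert s (T - {t}))"
    using *(10) hull_mono[OF G(2)] by blast
  \<comment> \<open>Solving \<open>s = a t + m\<close> for \<open>t\<close> with the left inverse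
    \<open>c\<close> of \<open>a\<close>.\<close>
  have "c \<odot>\<^bsub>M\<^esub> (s \<ominus>\<^bsub>M\<^esub> m) \<in> span (insert s (T - {t}))"
    using N'(4,5) c m hull_inc[of s "insert s (T - {t})"] by blast
  moreover have "s \<ominus>\<^bsub>M\<^esub> m = a \<odot>\<^bsub>M\<^esub> t"
    using *(11) m N'(1) ab tM by (auto simp: a_minus_def M.a_assoc smult_closed M.r_neg)
  then have "c \<odot>\<^bsub>M\<^esub> (s \<ominus>\<^bsub>M\<^esub> m) = t"
    using c ab tM smult_assoc1[of c a t] by (simp add: smult_one)
  ultimately have "t \<in> span (insert s (T - {t}))"
    by simp
  then show thesis
    using that t(1) * deg by blast
qed

section \<open>Counting generators in prescribed degrees\<close>

lemma disjoint_degrees: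
  assumes "\<gamma> \<in> carrier \<Gamma>" "\<delta> \<in> carrier \<Gamma>" "x \<in> \<M> \<gamma>" "x \<in> \<M> \<delta>" "x \<noteq> \<zero>\<^bsub>M\<^esub>"
  shows "\<gamma> = \<delta>"
  using M_sum.component_of_summand[of \<gamma> \<delta> x] M_sum.component_of_summand[of \<delta> \<delta> x] assms
  by (auto split: if_splits)

text \<open>
  An exchange step only alters degrees by an invertible factor \<open>\<alpha>\<close>. Both parts of the theorem are
  instances: \<open>D\<close> is the whole monoid in (i), and a singleton in (ii), where \<open>\<one>\<close> is the only
  invertible degree.
\<close>

lemma card_degree_le:
  assumes S: "finite S" "homogeneous_set S" "\<zero>\<^bsub>M\<^esub> \<notin> S" "span S = carrier M"
    and minimal: "\<And>s. s \<in> S \<Longrightarrow> s \<notin> span (S - {s})"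
    and D: "D \<subseteq> carrier \<Gamma>" "\<And>\<alpha> \<beta> \<tau>. \<lbrakk>\<alpha> \<in> carrier \<Gamma>; \<beta> \<in> carrier \<Gamma>; \<tau> \<in> carrier \<Gamma>;
      \<alpha> \<otimes>\<^bsub>\<Gamma>\<^esub> \<beta> = \<one>\<^bsub>\<Gamma>\<^esub>\<rbrakk> \<Longrightarrow> \<alpha> \<otimes>\<^bsub>\<Gamma>\<^esub> \<tau> \<in> D \<longleftrightarrow> \<tau> \<in> D"
    and T: "finite T" "homogeneous_set T" "\<zero>\<^bsub>M\<^esub> \<notin> T" "span T = carrier M"
  shows "card (S \<inter> (\<Union>\<gamma>\<in>D. \<M> \<gamma>)) \<le> card (T \<inter> (\<Union>\<gamma>\<in>D. \<M> \<gamma>))"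
  using T
\<comment> \<open>Each exchange brings one more element of \<open>S\<close> into \<open>T\<close>
  without changing the number of elements with degree in \<open>D\<close>; at the end
  \<open>S \<subseteq> T\<close>.\<close>
proof (induction "card (S - T)" arbitrary: T)
  case 0
  then have "S \<subseteq> T"
    using S(1) by simp
  then show ?case
    using 0 by (intro card_mono) auto
next
  case (Suc k)
  define E where "E = (\<Union>\<gamma>\<in>D. \<M> \<gamma>)"
  obtain s where s: "s \<in> S" "s \<notin> T"
    using Suc.hyps(2) by (metis Diff_iff card.empty ex_in_conv nat.distinct(1))
  obtain \<delta> where \<delta>: "\<delta> \<in> carrier \<Gamma>" "s \<in> \<M> \<delta>"
    using s S(2) by (auto simp: homogeneous_set_def)
  have F: "homogeneous_set (S - {s})" "span (insert s (S - {s})) = carrier M"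
    using S s by (auto simp: homogeneous_set_def insert_absorb)
  obtain t \<tau> \<alpha> \<beta> where t: "t \<in> T" "t \<notin> span (S - {s})" "t \<in> span (insert s (T - {t}))"
    and \<tau>: "\<tau> \<in> carrier \<Gamma>" "t \<in> \<M> \<tau>" and \<alpha>: "\<alpha> \<in> carrier \<Gamma>" "\<beta> \<in> carrier \<Gamma>"
    "\<alpha> \<otimes>\<^bsub>\<Gamma>\<^esub> \<beta> = \<one>\<^bsub>\<Gamma>\<^esub>" "\<alpha> \<otimes>\<^bsub>\<Gamma>\<^esub> \<tau> = \<delta>"
    by (rule homogeneous_exchange[OF \<delta> F(1) minimal[OF s(1)] F(2) Suc.prems(1,2,4)])
  \<comment> \<open>The element given up is not in \<open>S\<close>, so \<open>S - T\<close> loses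
    exactly \<open>s\<close>.\<close>
  have "t \<noteq> s" using t s by blast
  then have tS: "t \<notin> S"
    using t(2) hull_inc[of t "S - {s}"] by blast
  define T' where "T' = insert s (T - {t})"
  have T': "finite T'" "homogeneous_set T'" "\<zero>\<^bsub>M\<^esub> \<notin> T'"
    using Suc.prems S(2,3) s by (auto simp: T'_def homogeneous_set_def)
  have "T' \<subseteq> carrier M"
    using T'(2) by (rule homogeneous_set_closed)
  note N' = submodule_span[OF this]
  have "T \<subseteq> span T'"
  proof
    fix x assume "x \<in> T"
    then show "x \<in> span T'"
      using t(3) hull_inc[of x T'] by (cases "x = t") (auto simp: T'_def)
  qed
  then have "span T \<subseteq> span T'"
    using N' by (rule hull_minimal)
  then have "span T' = carrier M"
    using Suc.prems(4) submoduleD(1)[OF N'] by blast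
  moreover have "S - T' = (S - T) - {s}"
    using tS by (auto simp: T'_def)
  then have "k = card (S - T')"
    using Suc.hyps(2) s by simp
  ultimately have "card (S \<inter> E) \<le> card (T' \<inter> E)"
    using Suc.hyps(1) T' unfolding E_def by blast
  also have "\<dots> = card (T \<inter> E)"
  proof -
    \<comment> \<open>Nonzero elements have only one degree, so any known degree decides membership
      in \<open>E\<close>.\<close>
    have mem: "x \<in> E \<longleftrightarrow> \<gamma> \<in> D" if "\<gamma> \<in> carrier \<Gamma>" "x \<in> \<M> \<gamma>" "x \<noteq> \<zero>\<^bsub>M\<^esub>" for x \<gamma>
      using that disjoint_degrees[of \<gamma> _ x] D(1) unfolding E_def by blast
    \<comment> \<open>The degrees satisfy \<open>\<delta> = \<alpha> \<tau>\<close> with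
      \<open>\<alpha> \<beta> = e\<close>, and \<open>D\<close> respects such factors.\<close>
    have "s \<in> E \<longleftrightarrow> t \<in> E"
      using mem[OF \<delta>] mem[OF \<tau>] D(2)[OF \<alpha>(1,2) \<tau>(1) \<alpha>(3)] \<alpha>(4) s t S(3) Suc.prems(3) by metis
    show ?thesis
    proof (cases "t \<in> E")
      case True
      then have "T' \<inter> E = insert s (T \<inter> E - {t})"
        using \<open>s \<in> E \<longleftrightarrow> t \<in> E\<close> by (auto simp: T'_def)
      moreover have "card (insert s (T \<inter> E - {t})) = Suc (card (T \<inter> E - {t}))"
        using Suc.prems(1) s by simp
      moreover have "Suc (card (T \<inter> E - {t})) = card (T \<inter> E)"
        using Suc.prems(1) True t by (intro card_Suc_Diff1) auto
      ultimately show ?thesis by simp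
    next
      case False
      then have "T' \<inter> E = T \<inter> E"
        using \<open>s \<in> E \<longleftrightarrow> t \<in> E\<close> by (auto simp: T'_def)
      then show ?thesis by simp
    qed
  qed
  finally show ?case
    unfolding E_def .
qed

text \<open>Minimality becomes independence: a generator in the span of the others could be
  dropped.\<close>

lemma minimal_homogeneous_generating_setD:
  assumes "finitely_generated A M" "minimal_homogeneous_generating_set \<Gamma> A M \<M> S"
  shows "finite S" "homogeneous_set S" "\<zero>\<^bsub>M\<^esub> \<notin> S" "span S = carrier M"
    "s \<in> S \<Longrightarrow> s \<notin> span (S - {s})"
proof -
  have gen: "generates A M S" "\<And>T. T \<subset> S \<Longrightarrow> \<not> generates A M T"
    using assms(2) by (auto simp: minimal_homogeneous_generating_set_def)
  show "finite S"
    using minimal_generating_set_finite[OF assms(1) gen] .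
  show "homogeneous_set S" "\<zero>\<^bsub>M\<^esub> \<notin> S"
    using assms(2)
    by (auto simp: minimal_homogeneous_generating_set_def homogeneous_of_degree_def homogeneous_set_def)
  show span: "span S = carrier M"
    using gen(1) by (simp add: generates_def)
  assume s: "s \<in> S"
  show "s \<notin> span (S - {s})"
  proof
    assume "s \<in> span (S - {s})"
    then have "span (insert s (S - {s})) = span (S - {s})"
      by (rule hull_redundant)
    then have "generates A M (S - {s})"
      using s span gen(1) by (auto simp: generates_def insert_absorb)
    then show False
      using gen(2)[of "S - {s}"] s by blast
  qed
qed

text \<open>The counting inequality holds with \<open>S\<close> and \<open>T\<close> in either role,
  and for finite sets equal cardinality is equipollence.\<close>

lemma minimal_homogeneous_generating_sets_eqpoll:
  assumes fg: "finitely_generated A M"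
    and ST: "minimal_homogeneous_generating_set \<Gamma> A M \<M> S" "minimal_homogeneous_generating_set \<Gamma> A M \<M> T"
    and D: "D \<subseteq> carrier \<Gamma>" "\<And>\<alpha> \<beta> \<tau>. \<lbrakk>\<alpha> \<in> carrier \<Gamma>; \<beta> \<in> carrier \<Gamma>; \<tau> \<in> carrier \<Gamma>;
      \<alpha> \<otimes>\<^bsub>\<Gamma>\<^esub> \<beta> = \<one>\<^bsub>\<Gamma>\<^esub>\<rbrakk> \<Longrightarrow> \<alpha> \<otimes>\<^bsub>\<Gamma>\<^esub> \<tau> \<in> D \<longleftrightarrow> \<tau> \<in> D"
  shows "S \<inter> (\<Union>\<gamma>\<in>D. \<M> \<gamma>) \<approx> T \<inter> (\<Union>\<gamma>\<in>D. \<M> \<gamma>)"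
proof -
  note S = minimal_homogeneous_generating_setD[OF fg ST(1)]
  note T = minimal_homogeneous_generating_setD[OF fg ST(2)]
  have "card (S \<inter> (\<Union>\<gamma>\<in>D. \<M> \<gamma>)) = card (T \<inter> (\<Union>\<gamma>\<in>D. \<M> \<gamma>))"
    using card_degree_le[OF S D T(1-4)] card_degree_le[OF T D S(1-4)] by (rule le_antisym)
  then show ?thesis
    using S(1) T(1) by (simp add: eqpoll_iff_card)
qed

end

text \<open>If \<open>e\<close> precedes \<open>x\<close>, then \<open>y\<close> precedes
  \<open>x y = e\<close>, against \<open>e\<close> being smallest.\<close>

lemma (in totally_ordered_monoid) invertible_eq_one:
  assumes least: "\<And>x. \<lbrakk>x \<in> carrier G; x \<noteq> \<one>\<rbrakk> \<Longrightarrow> (\<one>, x) \<in> r"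
    and x: "x \<in> carrier G" and y: "y \<in> carrier G" and xy: "x \<otimes> y = \<one>"
  shows "x = \<one>"
proof (rule ccontr)
  assume "x \<noteq> \<one>"
  then have "(y, \<one>) \<in> r"
    using mult_right_mono[of \<one> x y] least x y xy by simp
  moreover have "trans r" "irrefl r"
    using strict_linear_order by (auto simp: strict_linear_order_on_def)
  ultimately show False
    using least[OF y] by (metis irrefl_def transD)
qed

theorem theorem3p4:
  fixes \<Gamma> :: "('g, 'h) monoid_scheme"
    and A :: "('a, 'c) ring_scheme"
    and \<A> :: "'g \<Rightarrow> 'a set"
    and M :: "('a, 'b, 'd) module_scheme"
    and \<M> :: "'g \<Rightarrow> 'b set"
  assumes "monoid_cancel \<Gamma>"
    and "graded_local_ring \<Gamma> A \<A>"
    and "graded_module \<Gamma> A \<A> M \<M>"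
    and "finitely_generated A M"
  shows "(\<forall>S T. minimal_homogeneous_generating_set \<Gamma> A M \<M> S \<longrightarrow>
                minimal_homogeneous_generating_set \<Gamma> A M \<M> T \<longrightarrow> S \<approx> T) \<and>
         (\<forall>r. totally_ordered_monoid \<Gamma> r \<longrightarrow>
              (\<forall>\<gamma>\<in>carrier \<Gamma>. \<gamma> \<noteq> \<one>\<^bsub>\<Gamma>\<^esub> \<longrightarrow> (\<one>\<^bsub>\<Gamma>\<^esub>, \<gamma>) \<in> r) \<longrightarrow>
              (\<forall>S T. minimal_homogeneous_generating_set \<Gamma> A M \<M> S \<longrightarrow>
                     minimal_homogeneous_generating_set \<Gamma> A M \<M> T \<longrightarrow>
                     (\<forall>\<gamma>\<in>carrier \<Gamma>.
                        {x \<in> S. homogeneous_of_degree M \<M> \<gamma> x} \<approx>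
                        {x \<in> T. homogeneous_of_degree M \<M> \<gamma> x})))"
proof -
  interpret graded_local_ring \<Gamma> A \<A> by fact
  interpret graded_module \<Gamma> A \<A> M \<M> by fact
  interpret monoid_cancel \<Gamma> by fact
  interpret cancel_graded_local_module \<Gamma> A \<A> M \<M> ..
  note D = minimal_homogeneous_generating_setD[OF assms(4)]
  note eqpoll = minimal_homogeneous_generating_sets_eqpoll[OF assms(4)]
  show ?thesis
  proof (intro conjI allI impI ballI)
    fix S T assume ST: "minimal_homogeneous_generating_set \<Gamma> A M \<M> S"
      "minimal_homogeneous_generating_set \<Gamma> A M \<M> T"
    have "U \<inter> (\<Union>\<gamma>\<in>carrier \<Gamma>. \<M> \<gamma>) = U" if "minimal_homogeneous_generating_set \<Gamma> A M \<M> U" for U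
      using D(2)[OF that] by (auto simp: homogeneous_set_def)
    then show "S \<approx> T"
      using eqpoll[OF ST, of "carrier \<Gamma>"] ST \<Gamma>.m_closed by simp
  next
    fix r S T \<gamma> assume r: "totally_ordered_monoid \<Gamma> r"
      and least: "\<forall>\<gamma>\<in>carrier \<Gamma>. \<gamma> \<noteq> \<one>\<^bsub>\<Gamma>\<^esub> \<longrightarrow> (\<one>\<^bsub>\<Gamma>\<^esub>, \<gamma>) \<in> r"
      and ST: "minimal_homogeneous_generating_set \<Gamma> A M \<M> S"
        "minimal_homogeneous_generating_set \<Gamma> A M \<M> T"
      and \<gamma>: "\<gamma> \<in> carrier \<Gamma>"
    \<comment> \<open>Second part: generators are nonzero, so those of degree
      \<open>\<gamma>\<close> are exactly those in \<open>\<M> \<gamma>\<close>. The singleton is an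
      admissible set of degrees because \<open>\<alpha> \<beta> = e\<close> forces
      \<open>\<alpha> = e\<close>.\<close>
    have "{x \<in> U. homogeneous_of_degree M \<M> \<gamma> x} = U \<inter> (\<Union>\<gamma>\<in>{\<gamma>}. \<M> \<gamma>)"
      if "minimal_homogeneous_generating_set \<Gamma> A M \<M> U" for U
      using D(3)[OF that] by (auto simp: homogeneous_of_degree_def)
    moreover have "\<alpha> \<otimes>\<^bsub>\<Gamma>\<^esub> \<tau> \<in> {\<gamma>} \<longleftrightarrow> \<tau> \<in> {\<gamma>}"
      if "\<alpha> \<in> carrier \<Gamma>" "\<beta> \<in> carrier \<Gamma>" "\<tau> \<in> carrier \<Gamma>" "\<alpha> \<otimes>\<^bsub>\<Gamma>\<^esub> \<beta> = \<one>\<^bsub>\<Gamma>\<^esub>" for \<alpha> \<beta> \<tau>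
      using totally_ordered_monoid.invertible_eq_one[OF r _ that(1,2,4)] least that(3) by simp
    ultimately show "{x \<in> S. homogeneous_of_degree M \<M> \<gamma> x} \<approx> {x \<in> T. homogeneous_of_degree M \<M> \<gamma> x}"
      using eqpoll[OF ST, of "{\<gamma>}"] ST \<gamma> by simp
  qed
qed

end
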